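(* Let $m\ge1$ and $n\ge 1$ be integers and let $t_{-m}\le\ldots\le t_0\le t_1\le\ldots\le t_{n-1}\le t_n\le\ldots\le t_{n+m}$ be any non-decreasing sequence of real knots with $t_0<t_n$, such that no inner knot $t_1,\ldots,t_{n-1}$ has multiplicity greater than $m$. Then the B-spline functions of the same degree $m$ over $[t_0,t_n]$ satisfy the differential-recurrence relation $$N_{m,i}(u)+\frac{t_i-u}{m}N'_{m,i}(u)=\frac{t_{m+i+1}-t_i}{t_{m+i+2}-t_{i+1}}\left(N_{m,i+1}(u)+\frac{t_{m+i+2}-u}{m}N'_{m,i+1}(u)\right)$$ for $i=-m-1,-m,\ldots,n-1$, with the convention that $N_{m,q}\equiv0$ for $q<-m$ or $q\ge n$.
   Context: B-spline functions: for $-m\le i<n$, the B-spline basis function of degree $m$ over $[t_0,t_n]$ built on the given knots is $N_{m,i}(u):=(t_{i+m+1}-t_i)\,[t_i,t_{i+1},\ldots,t_{i+m+1}]\,(t-u)_+^m$, where the generalized divided difference acts on the variable $t$, and the truncated power function is $(x-c)^m_+=(x-c)^m$ if $x\ge c$ and $0$ if $x<c$. The generalized divided difference $[x_0,\ldots,x_r]f$ is the coefficient of $x^r$ in the polynomial of degree at most $r$ that interpolates $f$ at $x_0,\ldots,x_r$ in the Hermite sense (a node repeated $s$ times means matching $f,f',\ldots,f^{(s-1)}$ there). The multiplicity of a knot is the number of times its value occurs in the knot sequence. Any quotient $Q/(t_k-t_\ell)$ with $t_k=t_\ell$ is taken to be $0$. The prime denotes the derivative with respect to $u$. For $i=-m-1$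 and $i=n-1$ the formula formally contains the symbols $t_{-m-1}$ and $t_{n+m+1}$, which are not part of the knot sequence and are left unspecified; in these cases $N_{m,-m-1}\equiv0$, respectively $N_{m,n}\equiv0$, by the convention. *)

theory Defs
  imports "HOL-Analysis.Analysis" "HOL-Computational_Algebra.Polynomial"
begin

definition truncated_power :: "nat \<Rightarrow> real \<Rightarrow> real \<Rightarrow> real" where
  "truncated_power m c x = (if x \<ge> c then (x - c) ^ m else 0)"

definition hermite_interpolates :: "real list \<Rightarrow> (real \<Rightarrow> real) \<Rightarrow> real poly \<Rightarrow> bool" where
  "hermite_interpolates xs f p \<longleftrightarrow>
     (\<forall>x\<in>set xs. \<forall>k<count_list xs x. poly ((pderiv ^^ k) p) x = (deriv ^^ k) f x)"

text \<open>For a nonempty list of nodes \<open>[x\<^sub>0, \<dots>, x\<^sub>r]\<close> we have \<open>length xs - 1 = r\<close>.\<close>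

definition divided_difference :: "real list \<Rightarrow> (real \<Rightarrow> real) \<Rightarrow> real" where
  "divided_difference xs f =
     coeff (THE p. degree p \<le> length xs - 1 \<and> hermite_interpolates xs f p) (length xs - 1)"

text \<open>The knot sequence is \<open>t\<close> restricted to the indices \<open>{-m..n+m}\<close>; the values of \<open>t\<close> at
  other indices are irrelevant and unconstrained.\<close>

definition knot_multiplicity :: "nat \<Rightarrow> nat \<Rightarrow> (int \<Rightarrow> real) \<Rightarrow> real \<Rightarrow> nat" where
  "knot_multiplicity m n t x = card {j \<in> {- int m..int n + int m}. t j = x}"

text \<open>If \<open>u\<close> is a knot of multiplicity \<open>m + 1\<close>, then \<open>\<lambda>x. truncated_power m u x\<close> has no \<open>m\<close>-th
  derivative at \<open>x = u\<close>, so the Hermite data, and hence the value at \<open>u\<close> of the B-splines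
  having \<open>u\<close> as an \<open>(m + 1)\<close>-fold node, are unspecified.\<close>

definition bspline :: "nat \<Rightarrow> nat \<Rightarrow> (int \<Rightarrow> real) \<Rightarrow> int \<Rightarrow> real \<Rightarrow> real" where
  "bspline m n t i u =
     (if - int m \<le> i \<and> i < int n
      then (t (i + int m + 1) - t i) *
             divided_difference (map t [i..i + int m + 1]) (\<lambda>x. truncated_power m u x)
      else 0)"

end

theory Submission imports Defs begin

text \<open>Write \<open>\<tau> = t\<^sub>i\<^sub>+\<^sub>m\<^sub>+\<^sub>1 - t\<^sub>i\<close> and \<open>h = (x - u)\<^sub>+\<^sup>m\<^sup>-\<^sup>1\<close>. Since \<open>(x - u)\<^sub>+\<^sup>m = (x - u) h\<close> has \<open>u\<close>-derivative
  \<open>- m h\<close>, the left-hand side is \<open>\<tau>\<close> times the divided difference of \<open>(x - t\<^sub>i) h\<close> at \<open>t\<^sub>i, \<dots>, t\<^sub>i\<^sub>+\<^sub>m\<^sub>+\<^sub>1\<close>,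
  that is \<open>\<tau>\<close> times the divided difference of \<open>h\<close> at \<open>t\<^sub>i\<^sub>+\<^sub>1, \<dots>, t\<^sub>i\<^sub>+\<^sub>m\<^sub>+\<^sub>1\<close>. The right-hand side reduces
  to the same expression by cancelling the factor \<open>x - t\<^sub>i\<^sub>+\<^sub>m\<^sub>+\<^sub>2\<close> instead. In the two boundary cases the
  common expression vanishes, as \<open>h\<close> is zero, respectively of degree \<open>m - 1\<close>, near all nodes.
  At a knot \<open>u\<close> a one-sided derivative forces the value and the derivative of the B-spline to be those
  of the polynomial piece on an adjacent knot-free interval, where the computation is valid.\<close>

subsection \<open>Hermite interpolation of prescribed data\<close>

text \<open>Data are prescribed freely, since at the kink of a truncated power they need not come
  from derivatives. The bound via coefficients makes 0 the only candidate for the empty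
  list.\<close>

definition interpolant :: "real list \<Rightarrow> (real \<Rightarrow> nat \<Rightarrow> real) \<Rightarrow> real poly \<Rightarrow> bool" where
  "interpolant xs d p \<longleftrightarrow> (\<forall>k\<ge>length xs. coeff p k = 0) \<and>
     (\<forall>x. \<forall>k<count_list xs x. poly ((pderiv ^^ k) p) x = d x k)"

definition hermite_dd :: "real list \<Rightarrow> (real \<Rightarrow> nat \<Rightarrow> real) \<Rightarrow> real" where
  "hermite_dd xs d = coeff (THE p. interpolant xs d p) (length xs - 1)"

text \<open>Differentiation lowers the order of a root by exactly one.\<close>

lemma le_order_iff_higher_pderiv:
  fixes p :: "real poly"
  assumes "p \<noteq> 0"
  shows "s \<le> order x p \<longleftrightarrow> (\<forall>k<s. poly ((pderiv ^^ k) p) x = 0)"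
  using assms
proof (induction s arbitrary: p)
  case (Suc s)
  show ?case
  proof (cases "poly p x = 0")
    case True
    have pd: "pderiv p \<noteq> 0"
    proof
      assume "pderiv p = 0"
      then have "Polynomial.degree p = 0" by (simp add: pderiv_eq_0_iff)
      then obtain c where "p = [:c:]" by (rule degree_eq_zeroE)
      with True Suc.prems show False by simp
    qed
    have "order x p = Suc (order x (pderiv p))"
      by (rule order_pderiv[OF Suc.prems True])
    moreover have "(\<forall>k<Suc s. poly ((pderiv ^^ k) p) x = 0) \<longleftrightarrow>
        (\<forall>k<s. poly ((pderiv ^^ k) (pderiv p)) x = 0)"
      using True by (simp add: All_less_Suc2 funpow_Suc_right del: funpow.simps)
    ultimately show ?thesis
      using Suc.IH[OF pd] by simp
  next
    case False
    then show ?thesis by (auto simp: order_0I intro!: exI[of _ 0])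
  qed
qed simp

text \<open>A nonzero difference of two interpolants would have at least \<open>length xs\<close>
  roots, counted with multiplicity, but smaller degree.\<close>

lemma interpolant_unique:
  assumes "interpolant xs d p" "interpolant xs d q"
  shows "p = q"
proof (rule ccontr)
  assume "p \<noteq> q"
  define r where "r = p - q"
  have r: "r \<noteq> 0" using \<open>p \<noteq> q\<close> by (simp add: r_def)
  have hd: "(pderiv ^^ k) r = (pderiv ^^ k) p - (pderiv ^^ k) q" for k
    unfolding r_def by (induction k) (simp_all add: pderiv_diff)
  have "count_list xs x \<le> order x r" for x
    using assms by (subst le_order_iff_higher_pderiv[OF r]) (auto simp: hd interpolant_def)
  then have "mset xs \<subseteq># proots r"
    using r by (intro mset_subset_eqI) (simp add: count_mset)
  then have "length xs \<le> size (proots r)"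
    by (metis size_mset size_mset_mono)
  also have "\<dots> \<le> Polynomial.degree r" by (rule size_proots_le)
  finally have "coeff r (Polynomial.degree r) = 0"
    using assms by (auto simp: r_def interpolant_def)
  with r show False by simp
qed

text \<open>Newton's construction: a new node \<open>z\<close> is served by adding a multiple of the
  nodal polynomial \<open>q\<close> of the old nodes, which leaves all old conditions
  intact.\<close>

lemma interpolant_exists: "\<exists>p. interpolant xs d p"
proof (induction xs)
  case Nil
  show ?case by (rule exI[of _ 0]) (simp add: interpolant_def)
next
  case (Cons z xs)
  then obtain p where p: "interpolant xs d p" by blast
  define q :: "real poly" where "q = (\<Prod>x\<leftarrow>xs. [:- x, 1:])"
  have q0: "q \<noteq> 0" by (auto simp: q_def prod_list_zero_iff)
  have ordq: "order x q = count_list xs x" for x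
  proof -
    have "[:- y, 1:] \<noteq> (0 :: real poly)" for y by simp
    then have "order x (\<Prod>y\<leftarrow>ys. [:- y, 1:]) = count_list ys x" for ys
    proof (induction ys)
      case (Cons y ys)
      have "(\<Prod>y\<leftarrow>ys. [:- y, 1:]) \<noteq> 0" by (auto simp: prod_list_zero_iff)
      moreover have "order x [:- y, 1:] = (if y = x then 1 else 0)"
        using order_power_n_n[of x 1] by (auto simp: order_0I)
      moreover from calculation have "order x ([:- y, 1:] * (\<Prod>y\<leftarrow>ys. [:- y, 1:])) =
          order x [:- y, 1:] + order x (\<Prod>y\<leftarrow>ys. [:- y, 1:])"
        by (intro order_mult no_zero_divisors) auto
      ultimately show ?case using Cons by (simp only: list.map prod_list.Cons) auto
    qed simp
    then show ?thesis unfolding q_def .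
  qed
  have degq: "Polynomial.degree q \<le> length xs"
    unfolding q_def
    by (rule order.trans[OF degree_prod_list_le]) (simp add: o_def sum_list_triv)
  define n where "n = count_list xs z"
  have qz: "poly ((pderiv ^^ k) q) x = 0" if "k < count_list xs x" for x k
    using le_order_iff_higher_pderiv[OF q0, of "count_list xs x" x] that by (simp add: ordq)
  have qn: "poly ((pderiv ^^ n) q) z \<noteq> 0"
    using le_order_iff_higher_pderiv[OF q0, of "Suc n" z] qz[of _ z]
    by (auto simp: ordq n_def less_Suc_eq)
  \<comment> \<open>The one new condition concerns the \<open>n\<close>-th derivative at
    \<open>z\<close>. As \<open>z\<close> has order exactly \<open>n\<close> in \<open>q\<close>, it
    is solvable for the coefficient \<open>c\<close>.\<close>
  define c where "c = (d z n - poly ((pderiv ^^ n) p) z) / poly ((pderiv ^^ n) q) z"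
  have hd: "poly ((pderiv ^^ k) (p + smult c q)) x =
      poly ((pderiv ^^ k) p) x + c * poly ((pderiv ^^ k) q) x" for k x
    by (simp add: higher_pderiv_add higher_pderiv_smult)
  have "interpolant (z # xs) d (p + smult c q)"
    unfolding interpolant_def
  proof (intro conjI allI impI)
    fix k assume "length (z # xs) \<le> k"
    then show "coeff (p + smult c q) k = 0"
      using p degq by (auto simp: interpolant_def coeff_eq_0)
  next
    fix x k assume k: "k < count_list (z # xs) x"
    show "poly ((pderiv ^^ k) (p + smult c q)) x = d x k"
    proof (cases "k < count_list xs x")
      case True
      then show ?thesis using p qz by (simp add: hd interpolant_def)
    next
      case False
      with k have "x = z" "k = n" by (auto simp: n_def split: if_splits)
      then show ?thesis using qn by (simp only: hd) (simp add: c_def)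
    qed
  qed
  then show ?case ..
qed

lemma hermite_dd_eqI:
  assumes "interpolant xs d p"
  shows "hermite_dd xs d = coeff p (length xs - 1)"
proof -
  have "(THE p. interpolant xs d p) = p"
    using assms interpolant_unique by blast
  then show ?thesis by (simp add: hermite_dd_def)
qed

lemma hermite_dd_cong:
  assumes "\<And>x k. x \<in> set xs \<Longrightarrow> k < count_list xs x \<Longrightarrow> d x k = e x k"
  shows "hermite_dd xs d = hermite_dd xs e"
proof -
  obtain p where p: "interpolant xs d p" using interpolant_exists by blast
  have "d x k = e x k" if "k < count_list xs x" for x k
  proof (rule assms)
    show "x \<in> set xs" using that count_notin[of x xs] by (cases "x \<in> set xs") auto
  qed (rule that)
  with p have "interpolant xs e p" by (simp add: interpolant_def)
  with p show ?thesis by (simp add: hermite_dd_eqI)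
qed

text \<open>For an empty list, truncated subtraction would turn the degree bound into one that
  admits nonzero constants.\<close>

lemma divided_difference_eq_hermite_dd:
  assumes "xs \<noteq> []"
  shows "divided_difference xs f = hermite_dd xs (\<lambda>x k. (deriv ^^ k) f x)"
proof -
  have deg: "Polynomial.degree p \<le> length xs - 1 \<longleftrightarrow> (\<forall>k\<ge>length xs. coeff p k = 0)"
    for p :: "real poly"
  proof
    assume "Polynomial.degree p \<le> length xs - 1"
    then show "\<forall>k\<ge>length xs. coeff p k = 0"
      using assms by (intro allI impI coeff_eq_0) (cases xs; auto)
  next
    assume *: "\<forall>k\<ge>length xs. coeff p k = 0"
    show "Polynomial.degree p \<le> length xs - 1"
      using * assms by (intro degree_le) (cases xs; auto)
  qed
  have mem: "x \<in> set xs" if "k < count_list xs x" for x k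
    using that count_notin[of x xs] by (cases "x \<in> set xs") auto
  have "(Polynomial.degree p \<le> length xs - 1 \<and> hermite_interpolates xs f p) \<longleftrightarrow>
      interpolant xs (\<lambda>x k. (deriv ^^ k) f x) p" for p
    unfolding deg interpolant_def hermite_interpolates_def using mem by blast
  then show ?thesis
    by (simp add: divided_difference_def hermite_dd_def)
qed

text \<open>The weights are the top coefficients of the Hermite basis polynomials
  \<open>L x k\<close>, the interpolants of unit data. They give linearity and termwise
  differentiation in a parameter.\<close>

lemma hermite_dd_weights:
  "\<exists>w. \<forall>d. hermite_dd xs d = (\<Sum>x\<in>set xs. \<Sum>k<count_list xs x. w x k * d x k)"
proof -
  define e where "e x k = (\<lambda>y j. if y = x \<and> j = k then 1 else (0::real))" for x :: real and k :: nat
  have "\<forall>x k. \<exists>p. interpolant xs (e x k) p" using interpolant_exists by blast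
  then obtain L where L: "\<And>x k. interpolant xs (e x k) (L x k)" by metis
  show ?thesis
  proof (intro exI[of _ "\<lambda>x k. coeff (L x k) (length xs - 1)"] allI)
    fix d
    let ?p = "\<Sum>x\<in>set xs. \<Sum>k<count_list xs x. smult (d x k) (L x k)"
    have "interpolant xs d ?p"
      unfolding interpolant_def
    proof (intro conjI allI impI)
      fix k assume "length xs \<le> k"
      then show "coeff ?p k = 0"
        using L by (simp add: coeff_sum interpolant_def)
    next
      fix y j assume j: "j < count_list xs y"
      have y: "y \<in> set xs" using j count_notin[of y xs] by (cases "y \<in> set xs") auto
      have "poly ((pderiv ^^ j) ?p) y =
          (\<Sum>x\<in>set xs. \<Sum>k<count_list xs x. d x k * poly ((pderiv ^^ j) (L x k)) y)"
        by (simp add: higher_pderiv_sum higher_pderiv_smult poly_sum)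
      also have "\<dots> = (\<Sum>x\<in>set xs. \<Sum>k<count_list xs x. d x k * e x k y j)"
        using L j by (simp add: interpolant_def)
      also have "\<dots> = (\<Sum>x\<in>set xs. if x = y then d y j else 0)"
      proof (rule sum.cong[OF refl])
        fix x
        show "(\<Sum>k<count_list xs x. d x k * e x k y j) = (if x = y then d y j else 0)"
          using j by (cases "x = y") (simp_all add: e_def if_distrib cong: if_cong)
      qed
      also have "\<dots> = d y j" using y by simp
      finally show "poly ((pderiv ^^ j) ?p) y = d y j" .
    qed
    then show "hermite_dd xs d =
        (\<Sum>x\<in>set xs. \<Sum>k<count_list xs x. coeff (L x k) (length xs - 1) * d x k)"
      by (simp add: hermite_dd_eqI coeff_sum mult.commute)
  qed
qed

lemma hermite_dd_diff:
  "hermite_dd xs d - c * hermite_dd xs e = hermite_dd xs (\<lambda>x k. d x k - c * e x k)"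
proof -
  obtain w where w: "\<And>d. hermite_dd xs d = (\<Sum>x\<in>set xs. \<Sum>k<count_list xs x. w x k * d x k)"
    using hermite_dd_weights by blast
  show ?thesis
    by (simp add: w sum_distrib_left sum_subtractf algebra_simps)
qed

text \<open>Leibniz's rule stops after two terms for a linear factor. At \<open>k = 0\<close> the
  truncated index \<open>k - 1\<close> is harmless because its factor is 0.\<close>

lemma higher_pderiv_linear_mult:
  fixes p :: "real poly"
  shows "(pderiv ^^ k) ([:- c, 1:] * p) =
    [:- c, 1:] * (pderiv ^^ k) p + smult (real k) ((pderiv ^^ (k - 1)) p)"
proof (induction k)
  case (Suc k)
  have "(pderiv ^^ Suc k) ([:- c, 1:] * p) =
      pderiv ([:- c, 1:] * (pderiv ^^ k) p) + smult (real k) (pderiv ((pderiv ^^ (k - 1)) p))"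
    using Suc by (simp add: pderiv_add pderiv_smult)
  also have "smult (real k) (pderiv ((pderiv ^^ (k - 1)) p)) = smult (real k) ((pderiv ^^ k) p)"
    by (cases k) simp_all
  also have "pderiv ([:- c, 1:] * (pderiv ^^ k) p) =
      [:- c, 1:] * (pderiv ^^ Suc k) p + (pderiv ^^ k) p"
    by (simp only: pderiv_mult) (simp add: pderiv_pCons)
  finally show ?case by (simp add: smult_add_left algebra_simps)
qed simp

text \<open>The data below are those of \<open>(x - c) f\<close> when \<open>d\<close> are the data of \<open>f\<close>, by Leibniz's rule.\<close>

lemma hermite_dd_Cons_mult:
  assumes "xs \<noteq> []"
  shows "hermite_dd (c # xs) (\<lambda>x k. (x - c) * d x k + real k * d x (k - 1)) = hermite_dd xs d"
proof -
  obtain p where p: "interpolant xs d p" using interpolant_exists by blast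
  let ?q = "[:- c, 1:] * p"
  \<comment> \<open>The other contribution, \<open>- c * coeff p k\<close>, vanishes by the degree
    bound, so the top coefficient just moves up by one.\<close>
  have cf: "coeff ?q k = coeff p (k - 1)" if "k \<ge> length xs" for k
    using that p assms by (cases k) (auto simp: interpolant_def)
  have hd: "poly ((pderiv ^^ k) ?q) x =
      (x - c) * poly ((pderiv ^^ k) p) x + real k * poly ((pderiv ^^ (k - 1)) p) x" for k x
    by (simp only: higher_pderiv_linear_mult) (simp add: algebra_simps)
  have "interpolant (c # xs) (\<lambda>x k. (x - c) * d x k + real k * d x (k - 1)) ?q"
    unfolding interpolant_def
  proof (intro conjI allI impI)
    fix k assume "length (c # xs) \<le> k"
    then show "coeff ?q k = 0"
      using p by (subst cf) (auto simp: interpolant_def)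
  next
    fix x k assume k: "k < count_list (c # xs) x"
    \<comment> \<open>The highest order at \<open>x = c\<close> may not be matched by
      \<open>p\<close>, but there the factor \<open>x - c\<close> is 0.\<close>
    have "(x - c) * poly ((pderiv ^^ k) p) x = (x - c) * d x k"
      using p k by (cases "x = c") (auto simp: interpolant_def)
    moreover have "real k * poly ((pderiv ^^ (k - 1)) p) x = real k * d x (k - 1)"
      using p k by (cases k) (auto simp: interpolant_def split: if_splits)
    ultimately show "poly ((pderiv ^^ k) ?q) x = (x - c) * d x k + real k * d x (k - 1)"
      by (simp only: hd)
  qed
  then have "hermite_dd (c # xs) (\<lambda>x k. (x - c) * d x k + real k * d x (k - 1)) =
      coeff ?q (length xs)"
    by (simp only: hermite_dd_eqI length_Cons diff_Suc_1)
  also have "\<dots> = hermite_dd xs d"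
    using p by (simp only: cf hermite_dd_eqI le_refl)
  finally show ?thesis .
qed

text \<open>Nodes enter only through their multiplicities, so a last node can be cancelled like a
  first one.\<close>

lemma hermite_dd_snoc: "hermite_dd (xs @ [c]) d = hermite_dd (c # xs) d"
proof -
  have "count_list (xs @ [c]) x = count_list (c # xs) x" for x by simp
  then have "interpolant (xs @ [c]) d = interpolant (c # xs) d"
    unfolding interpolant_def by (intro ext) (simp only: length_append list.size add_0 add_Suc_right add_0_right)
  then show ?thesis by (simp add: hermite_dd_def)
qed

subsection \<open>Hermite data of truncated powers\<close>

definition power_deriv :: "nat \<Rightarrow> nat \<Rightarrow> real \<Rightarrow> real" where
  "power_deriv m k y = poly ((pderiv ^^ k) (monom 1 m)) y"

text \<open>The strict inequality matters only at the kink, where for \<open>k < m\<close> the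
  polynomial branch gives 0 as well.\<close>

definition trunc_deriv :: "nat \<Rightarrow> nat \<Rightarrow> real \<Rightarrow> real" where
  "trunc_deriv m k y = (if y > 0 then power_deriv m k y else 0)"

lemma power_deriv_0 [simp]: "power_deriv m 0 y = y ^ m"
  by (simp add: power_deriv_def poly_monom)

lemma power_deriv_Suc:
  assumes "m \<ge> 1"
  shows "power_deriv m (Suc k) y = real m * power_deriv (m - 1) k y"
proof -
  have "pderiv (monom 1 m :: real poly) = smult (real m) (monom 1 (m - 1))"
    by (simp add: pderiv_monom smult_monom)
  then show ?thesis
    by (simp add: power_deriv_def funpow_Suc_right higher_pderiv_smult del: funpow.simps)
qed

lemma power_deriv_Leibniz:
  assumes "m \<ge> 1"
  shows "power_deriv m k y = y * power_deriv (m - 1) k y + real k * power_deriv (m - 1) (k - 1) y"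
proof -
  have "(monom 1 m :: real poly) = [:- 0, 1:] * monom 1 (m - 1)"
    using assms by (cases m) (simp_all add: monom_Suc)
  then show ?thesis
    unfolding power_deriv_def by (simp only: higher_pderiv_linear_mult) simp
qed

lemma power_deriv_at_0: "k < m \<Longrightarrow> power_deriv m k 0 = 0"
proof (induction k arbitrary: m)
  case (Suc k)
  then show ?case by (subst power_deriv_Suc) auto
qed simp

lemma DERIV_power_deriv: "(power_deriv m k has_real_derivative power_deriv m (Suc k) y) (at y)"
  unfolding power_deriv_def [abs_def] by simp

text \<open>Away from 0 the function is locally a polynomial or zero. At 0 its difference quotient
  is dominated by that of \<open>power_deriv m k\<close>, which tends to 0.\<close>

lemma DERIV_trunc_deriv:
  assumes "y \<noteq> 0 \<or> Suc k < m"
  shows "(trunc_deriv m k has_real_derivative trunc_deriv m (Suc k) y) (at y)"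
proof -
  consider "y > 0" | "y < 0" | "y = 0" "Suc k < m" using assms by linarith
  then show ?thesis
  proof cases
    case 1
    then have "eventually (\<lambda>z. trunc_deriv m k z = power_deriv m k z) (nhds y)"
      using eventually_nhds_in_open[of "{0<..}" y] by (auto elim!: eventually_mono simp: trunc_deriv_def)
    then show ?thesis
      using 1 DERIV_power_deriv[of m k y] by (subst DERIV_cong_ev[OF refl _ refl]) (auto simp: trunc_deriv_def)
  next
    case 2
    then have "eventually (\<lambda>z. trunc_deriv m k z = 0) (nhds y)"
      using eventually_nhds_in_open[of "{..<0}" y] by (auto elim!: eventually_mono simp: trunc_deriv_def)
    then show ?thesis
      using 2 by (subst DERIV_cong_ev[OF refl _ refl]) (auto simp: trunc_deriv_def)
  next
    case 3
    have 0: "power_deriv m k 0 = 0" "power_deriv m (Suc k) 0 = 0"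
      using 3 by (auto intro: power_deriv_at_0)
    have lim: "((\<lambda>h. power_deriv m k h / h) \<longlongrightarrow> 0) (at 0)"
      using DERIV_power_deriv[of m k 0] by (simp add: DERIV_def 0)
    have "((\<lambda>h. trunc_deriv m k h / h) \<longlongrightarrow> 0) (at 0)"
    proof (rule Lim_null_comparison[OF _ tendsto_norm_zero[OF lim]])
      show "eventually (\<lambda>h. norm (trunc_deriv m k h / h) \<le> norm (power_deriv m k h / h)) (at 0)"
        by (intro always_eventually allI) (simp add: trunc_deriv_def del: norm_divide real_norm_def)
    qed
    then show ?thesis using 3 by (simp add: DERIV_def trunc_deriv_def)
  qed
qed

lemma DERIV_trunc_deriv_shift:
  assumes "v \<noteq> x \<or> Suc k < m"
  shows "((\<lambda>v. trunc_deriv m k (x - v)) has_real_derivative - trunc_deriv m (Suc k) (x - v)) (at v)"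
proof -
  have "((\<lambda>v. trunc_deriv m k (x - v)) has_real_derivative trunc_deriv m (Suc k) (x - v) * (0 - 1)) (at v)"
    using assms by (intro DERIV_chain2[OF DERIV_trunc_deriv] DERIV_diff DERIV_const DERIV_ident) auto
  then show ?thesis by simp
qed

text \<open>Each differentiation needs the previous order on a whole neighbourhood: at the kink the
  bound on \<open>k\<close> gives it everywhere, elsewhere a neighbourhood avoiding \<open>v\<close>
  suffices.\<close>

lemma higher_deriv_truncated_power:
  assumes "x \<noteq> v \<or> k < m"
  shows "(deriv ^^ k) (truncated_power m v) x = trunc_deriv m k (x - v)"
  using assms
proof (induction k arbitrary: x)
  case 0
  then show ?case by (auto simp: truncated_power_def trunc_deriv_def)
next
  case (Suc k)
  have ev: "eventually (\<lambda>z. (deriv ^^ k) (truncated_power m v) z = trunc_deriv m k (z - v)) (nhds x)"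
  proof (cases "x = v")
    case True
    then show ?thesis using Suc by (intro always_eventually) auto
  next
    case False
    then have "eventually (\<lambda>z. z \<noteq> v) (nhds x)"
      using eventually_nhds_in_open[of "- {v}" x] by (auto simp: open_Compl)
    then show ?thesis by eventually_elim (simp add: Suc.IH)
  qed
  have "((\<lambda>z. trunc_deriv m k (z - v)) has_real_derivative trunc_deriv m (Suc k) (x - v) * (1 - 0)) (at x)"
    using Suc.prems by (intro DERIV_chain2[OF DERIV_trunc_deriv] DERIV_diff DERIV_const DERIV_ident) auto
  then have "deriv (\<lambda>z. trunc_deriv m k (z - v)) x = trunc_deriv m (Suc k) (x - v)"
    by (simp add: DERIV_imp_deriv)
  with deriv_cong_ev[OF ev refl] show ?case by simp
qed

text \<open>This admits the order \<open>k = m - 1\<close> at the kink: an end of the interval sees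
  one side only, where the function is zero (at \<open>a\<close>) or polynomial (at
  \<open>b\<close>).\<close>

lemma differentiable_trunc_deriv_endpoint:
  assumes "u = a \<or> u = b" "k < m"
  shows "(\<lambda>v. trunc_deriv m k (u - v)) differentiable (at u within {a..b})"
proof (cases "u \<in> {a..b}")
  case u: True
  show ?thesis
  proof (cases "u = a")
    case True
    then have "trunc_deriv m k (u - v) = 0" if "v \<in> {a..b}" for v
      using that by (simp add: trunc_deriv_def)
    moreover have "(\<lambda>v. 0 :: real) differentiable (at u within {a..b})" by simp
    ultimately show ?thesis
      using u by (metis (no_types, lifting) differentiable_transform_within zero_less_one)
  next
    case False
    then have "u = b" using assms by simp
    then have *: "trunc_deriv m k (u - v) = power_deriv m k (u - v)" if "v \<in> {a..b}" for v
      using that power_deriv_at_0[OF assms(2)] by (cases "v = u") (auto simp: trunc_deriv_def)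
    have "((\<lambda>v. power_deriv m k (u - v)) has_real_derivative power_deriv m (Suc k) (u - u) * (0 - 1)) (at u)"
      by (intro DERIV_chain2[OF DERIV_power_deriv] DERIV_diff DERIV_const DERIV_ident)
    then have "(\<lambda>v. power_deriv m k (u - v)) differentiable (at u within {a..b})"
      using differentiable_at_withinI real_differentiable_def by blast
    with * u show ?thesis
      by (metis (no_types, lifting) differentiable_transform_within zero_less_one)
  qed
next
  \<comment> \<open>Now \<open>{a..b}\<close> is empty and the filter is trivial.\<close>
  case False
  then have "at u within {a..b} = bot"
    by (simp add: at_within_eq_bot_iff)
  then show ?thesis by (auto simp: differentiable_def has_derivative_def bounded_linear_zero intro!: exI[of _ "\<lambda>_. 0"])
qed

section \<open>Divided differences of the data belonging to a knot-free interval\<close>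

text \<open>On a knot-free interval \<open>(c, d)\<close> the condition \<open>x > u\<close> on a knot \<open>x\<close> becomes \<open>x \<ge> d\<close>,
  which no longer depends on \<open>u\<close>. This makes the data polynomial in \<open>u\<close>, including at the ends.\<close>

definition gap_data :: "real \<Rightarrow> nat \<Rightarrow> real \<Rightarrow> real \<Rightarrow> nat \<Rightarrow> real" where
  "gap_data d m u x k = (if x \<ge> d then power_deriv m k (x - u) else 0)"

text \<open>Leibniz's rule for \<open>(x - u)^m = (x - u) * (x - u)^(m - 1)\<close>, with
  \<open>x - u\<close> split as \<open>(x - c) + (c - u)\<close>.\<close>

lemma gap_data_Leibniz:
  assumes "m \<ge> 1"
  shows "gap_data d m u x k - (c - u) * gap_data d (m - 1) u x k =
    (x - c) * gap_data d (m - 1) u x k + real k * gap_data d (m - 1) u x (k - 1)"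
  using power_deriv_Leibniz[OF assms, of k "x - u"] by (simp add: gap_data_def algebra_simps)

text \<open>The core of the recurrence: the combination of value and derivative on the left drops
  the node \<open>c\<close>.\<close>

lemma hermite_dd_gap_data:
  assumes "m \<ge> 1" "xs \<noteq> []"
  shows "hermite_dd (c # xs) (gap_data d m u) - (c - u) * hermite_dd (c # xs) (gap_data d (m - 1) u) =
    hermite_dd xs (gap_data d (m - 1) u)"
  by (simp only: hermite_dd_diff gap_data_Leibniz[OF assms(1)] hermite_dd_Cons_mult[OF assms(2)])

lemma DERIV_hermite_dd_gap_data:
  assumes "m \<ge> 1"
  shows "((\<lambda>u. hermite_dd xs (gap_data d m u)) has_real_derivative
    - real m * hermite_dd xs (gap_data d (m - 1) u)) (at u)"
proof -
  obtain w where w: "\<And>d. hermite_dd xs d = (\<Sum>x\<in>set xs. \<Sum>k<count_list xs x. w x k * d x k)"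
    using hermite_dd_weights by blast
  have *: "((\<lambda>u. gap_data d m u x k) has_real_derivative - real m * gap_data d (m - 1) u x k) (at u)" for x k
  proof (cases "x \<ge> d")
    case True
    have "((\<lambda>v. power_deriv m k (x - v)) has_real_derivative power_deriv m (Suc k) (x - u) * (0 - 1)) (at u)"
      by (intro DERIV_chain2[OF DERIV_power_deriv] DERIV_diff DERIV_const DERIV_ident)
    with True show ?thesis by (simp add: gap_data_def power_deriv_Suc[OF assms])
  qed (simp add: gap_data_def)
  have "((\<lambda>u. \<Sum>x\<in>set xs. \<Sum>k<count_list xs x. w x k * gap_data d m u x k) has_real_derivative
      (\<Sum>x\<in>set xs. \<Sum>k<count_list xs x. w x k * (- real m * gap_data d (m - 1) u x k))) (at u)"
    by (intro DERIV_sum DERIV_cmult *)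
  then show ?thesis
    by (simp add: w sum_distrib_left sum_negf mult.left_commute)
qed

lemma hermite_dd_gap_data_left:
  assumes "\<And>x. x \<in> set xs \<Longrightarrow> x < d"
  shows "hermite_dd xs (gap_data d m u) = 0"
proof -
  have "hermite_dd xs (gap_data d m u) = hermite_dd xs (\<lambda>_ _. 0)"
    using assms by (intro hermite_dd_cong) (force simp: gap_data_def)
  also have "\<dots> = 0"
    by (subst hermite_dd_eqI[of _ _ 0]) (auto simp: interpolant_def)
  finally show ?thesis .
qed

text \<open>The data are those of the polynomial \<open>(x - u)^m\<close>, which interpolates itself
  and has degree below the top index.\<close>

lemma hermite_dd_gap_data_right:
  assumes "\<And>x. x \<in> set xs \<Longrightarrow> x \<ge> d" and "Suc m < length xs"
  shows "hermite_dd xs (gap_data d m u) = 0"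
proof -
  \<comment> \<open>\<open>q 0\<close> is \<open>(x - u)^m\<close> as a polynomial in
    \<open>x\<close>, and \<open>q k\<close> its \<open>k\<close>-th derivative.\<close>
  define q :: "nat \<Rightarrow> real poly" where "q k = pcompose ((pderiv ^^ k) (monom 1 m)) [:- u, 1:]" for k
  have q: "(pderiv ^^ k) (q 0) = q k" for k
    by (induction k) (simp_all add: q_def pderiv_pcompose pderiv_pCons)
  have "Polynomial.degree (q 0) = m"
    by (simp add: q_def degree_pcompose degree_monom_eq)
  then have c: "coeff (q 0) j = 0" if "j > m" for j
    using that by (simp add: coeff_eq_0)
  have "interpolant xs (\<lambda>x k. power_deriv m k (x - u)) (q 0)"
    unfolding interpolant_def q using assms(2) c
    by (auto simp: q_def poly_pcompose power_deriv_def)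
  then have "hermite_dd xs (\<lambda>x k. power_deriv m k (x - u)) = 0"
    using assms(2) by (simp add: hermite_dd_eqI c)
  moreover have "hermite_dd xs (gap_data d m u) = hermite_dd xs (\<lambda>x k. power_deriv m k (x - u))"
    using assms(1) by (intro hermite_dd_cong) (simp add: gap_data_def)
  ultimately show ?thesis by simp
qed

section \<open>Knot counts, knot-free intervals and derivatives along them\<close>

lemma count_list_map_upto_le:
  assumes "{i..j} \<subseteq> A" "finite A"
  shows "count_list (map t [i..j]) x \<le> card {k \<in> A. t k = x}"
proof -
  have "count_list (map t [i..j]) x = card {k \<in> {i..j}. t k = x}"
    by (simp add: count_list_eq_length_filter filter_map o_def distinct_length_filter eq_commute
        Int_def conj_commute)
  also have "\<dots> \<le> card {k \<in> A. t k = x}"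
    using assms by (intro card_mono) auto
  finally show ?thesis .
qed

text \<open>The interval runs from \<open>u\<close> to the next knot or \<open>b\<close>; if
  \<open>u = b\<close>, it runs from the previous knot or \<open>a\<close> to
  \<open>u\<close>.\<close>

lemma knot_gap:
  fixes u :: real
  assumes "finite K" "a < b" "u \<in> {a..b}"
  obtains c d where "a \<le> c" "c < d" "d \<le> b" "u \<in> {c..d}" "\<forall>x\<in>K. x \<le> c \<or> d \<le> x"
proof (cases "u < b")
  case True
  define e where "e = Min (insert b {x \<in> K. u < x})"
  have fin: "finite (insert b {x \<in> K. u < x})" using assms by simp
  then have "u < e" using True unfolding e_def by (subst Min_gr_iff) auto
  moreover have "e \<le> b" using fin unfolding e_def by (intro Min_le) auto
  moreover have "x \<le> u \<or> e \<le> x" if "x \<in> K" for x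
    using fin that unfolding e_def by (cases "x \<le> u") (auto intro: Min_le)
  ultimately show ?thesis using assms by (intro that[of u e]) auto
next
  case False
  then have u: "u = b" using assms by simp
  define e where "e = Max (insert a {x \<in> K. x < b})"
  have fin: "finite (insert a {x \<in> K. x < b})" using assms by simp
  then have "e < b" using assms unfolding e_def by (subst Max_less_iff) auto
  moreover have "a \<le> e" using fin unfolding e_def by (intro Max_ge) auto
  moreover have "x \<le> e \<or> b \<le> x" if "x \<in> K" for x
    using fin that unfolding e_def by (cases "b \<le> x") (auto intro: Max_ge)
  ultimately show ?thesis using u by (intro that[of e b]) auto
qed

text \<open>Having a derivative makes \<open>f\<close> continuous at \<open>u\<close> within
  \<open>{a..b}\<close>, so even an unspecified value \<open>f u\<close> is the limit of
  \<open>g\<close> through the gap. Derivatives are then compared along the gap.\<close>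

lemma DERIV_within_eqI:
  fixes f g :: "real \<Rightarrow> real"
  assumes "(f has_real_derivative D) (at u within {a..b})" and "(g has_real_derivative E) (at u)"
    and "a \<le> c" "c < d" "d \<le> b" "u \<in> {c..d}"
    and eq: "\<And>v. v \<in> {c<..<d} \<Longrightarrow> f v = g v"
  shows "f u = g u" and "D = E"
proof -
  let ?F = "at u within {c<..<d}"
  \<comment> \<open>\<open>u\<close> is a limit point of the open gap even when it is one of its
    ends.\<close>
  have nb: "?F \<noteq> bot"
    using assms(4,6) islimpt_greaterThanLessThan1[of c d] islimpt_greaterThanLessThan2[of c d]
      interior_limit_point[of u "{c<..<d}"]
    by (cases "u = c \<or> u = d") (auto simp: trivial_limit_within interior_open)
  have f: "(f has_real_derivative D) ?F"
    using assms(3-5) by (intro DERIV_subset[OF assms(1)]) auto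
  have g: "(g has_real_derivative E) ?F"
    using assms(2) by (rule has_field_derivative_at_within)
  have tf: "(f \<longlongrightarrow> f u) ?F" and tg: "(g \<longlongrightarrow> g u) ?F"
    using DERIV_continuous[OF f] DERIV_continuous[OF g] by (simp_all add: continuous_within)
  have ev: "eventually (\<lambda>v. f v = g v) ?F"
    using eq by (auto simp: eventually_at_filter)
  show fu: "f u = g u"
    using tendsto_unique[OF nb _ tg] tf tendsto_cong[OF ev] by blast
  have "(g has_real_derivative D) ?F"
    using f fu ev by (subst has_field_derivative_cong_eventually[of g f]) (auto elim: eventually_mono)
  with g nb show "D = E"
    by (metis has_field_derivative_unique)
qed

subsection \<open>B-splines\<close>

locale knots =
  fixes m n :: nat and t :: "int \<Rightarrow> real"
  assumes m: "m \<ge> 1"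
    and n: "n \<ge> 1"
    and mono: "mono_on {- int m..int n + int m} t"
    and ends: "t 0 < t (int n)"
    and inner: "\<And>j. j \<in> {1..int n - 1} \<Longrightarrow> knot_multiplicity m n t (t j) \<le> m"
begin

definition nodes :: "int \<Rightarrow> real list" where
  "nodes i = map t [i..i + int m + 1]"

text \<open>These are the nodes shared by the B-splines with indices \<open>i\<close> and
  \<open>i + 1\<close>.\<close>

definition middle_nodes :: "int \<Rightarrow> real list" where
  "middle_nodes i = map t [i + 1..i + int m + 1]"

lemma nodes_ne: "nodes i \<noteq> []" "middle_nodes i \<noteq> []"
  by (simp_all add: nodes_def middle_nodes_def)

lemma nodes_eq_Cons: "nodes i = t i # middle_nodes i"
  by (simp add: nodes_def middle_nodes_def upto_rec1)

lemma nodes_eq_snoc: "nodes (i + 1) = middle_nodes i @ [t (int m + i + 2)]"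
  by (simp add: nodes_def middle_nodes_def upto_rec2 algebra_simps)

lemma length_middle_nodes: "length (middle_nodes i) = m + 1"
  by (simp add: middle_nodes_def)

lemma set_middle_nodes: "set (middle_nodes i) = t ` {i + 1..i + int m + 1}"
  by (simp add: middle_nodes_def)

lemma set_nodes_subset:
  assumes "- int m \<le> i" "i < int n"
  shows "set (nodes i) \<subseteq> t ` {- int m..int n + int m}"
  using assms by (auto simp: nodes_def)

lemma count_nodes_le:
  assumes "- int m \<le> i" "i < int n"
  shows "count_list (nodes i) x \<le> knot_multiplicity m n t x"
  unfolding nodes_def knot_multiplicity_def using assms
  by (intro count_list_map_upto_le) auto

lemma bspline_eq:
  assumes "- int m \<le> i" "i < int n"
  shows "bspline m n t i u = (t (i + int m + 1) - t i) *
    hermite_dd (nodes i) (\<lambda>x k. (deriv ^^ k) (truncated_power m u) x)"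
  using assms nodes_ne(1)[of i] by (simp add: bspline_def divided_difference_eq_hermite_dd nodes_def)

text \<open>Otherwise \<open>m + 2\<close> knots coincide. An inner one among them would be too
  multiple; with none, \<open>t 0\<close> and \<open>t (int n)\<close> are both among them.\<close>

lemma knot_length_pos:
  assumes "- int m \<le> i" "i < int n"
  shows "t i < t (i + int m + 1)"
proof (rule ccontr)
  assume "\<not> t i < t (i + int m + 1)"
  moreover have le: "t j \<le> t k" if "j \<in> {- int m..int n + int m}" "k \<in> {- int m..int n + int m}" "j \<le> k" for j k
    using mono that by (auto simp: mono_on_def)
  ultimately have eq: "t j = t i" if "j \<in> {i..i + int m + 1}" for j
    using le[of i j] le[of j "i + int m + 1"] that assms by fastforce
  show False
  proof (cases "\<exists>j. j \<in> {1..int n - 1} \<inter> {i..i + int m + 1}")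
    case True
    then obtain j where j: "j \<in> {1..int n - 1}" "j \<in> {i..i + int m + 1}" by auto
    have "card {i..i + int m + 1} \<le> card {k \<in> {- int m..int n + int m}. t k = t j}"
    proof (intro card_mono subsetI CollectI conjI)
      fix k assume k: "k \<in> {i..i + int m + 1}"
      show "t k = t j" using eq[OF k] eq[OF j(2)] by simp
      show "k \<in> {- int m..int n + int m}" using k assms by auto
    qed (rule finite_subset[of _ "{- int m..int n + int m}"], auto)
    also have "\<dots> \<le> m" using inner[OF j(1)] by (simp add: knot_multiplicity_def)
    finally show False by simp
  next
    case False
    \<comment> \<open>For \<open>n > 1\<close> the index \<open>max 1 i\<close> would be an inner
      one in the window.\<close>
    have "n = 1" "i \<le> 0"
      using False assms n by (auto dest: spec[of _ "max 1 i"])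
    with eq[of 0] eq[of 1] assms(1) ends show False by auto
  qed
qed

text \<open>Near \<open>u\<close> the B-spline is a fixed combination of shifted
  \<open>trunc_deriv m k\<close>. Only terms at the node \<open>u\<close> have their kink there, and
  its multiplicity bounds their order \<open>k\<close>.\<close>

lemma differentiable_bspline:
  assumes mult: "knot_multiplicity m n t u < m \<or> u \<in> {a, b} \<and> knot_multiplicity m n t u \<le> m"
  shows "bspline m n t i differentiable (at u within {a..b})"
proof (cases "- int m \<le> i \<and> i < int n")
  case True
  then have i: "- int m \<le> i" "i < int n" by auto
  let ?xs = "nodes i"
  obtain w where w: "\<And>d. hermite_dd ?xs d = (\<Sum>x\<in>set ?xs. \<Sum>k<count_list ?xs x. w x k * d x k)"
    using hermite_dd_weights by blast
  let ?f = "\<lambda>v. (t (i + int m + 1) - t i) *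
    (\<Sum>x\<in>set ?xs. \<Sum>k<count_list ?xs x. w x k * trunc_deriv m k (x - v))"
  have cu: "count_list ?xs u < m \<or> (u = a \<or> u = b) \<and> count_list ?xs u \<le> m"
    using mult count_nodes_le[OF i, of u] by auto
  \<comment> \<open>Other nodes may have multiplicity above \<open>m\<close>, so they are excluded
    here and avoided below by a small neighbourhood of \<open>u\<close>.\<close>
  have eq: "bspline m n t i v = ?f v" if "v \<notin> set ?xs \<or> v = u" for v
  proof -
    have "hermite_dd ?xs (\<lambda>x k. (deriv ^^ k) (truncated_power m v) x) =
        hermite_dd ?xs (\<lambda>x k. trunc_deriv m k (x - v))"
      using that cu by (intro hermite_dd_cong higher_deriv_truncated_power) auto
    then show ?thesis by (simp add: bspline_eq[OF i] w)
  qed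
  have diff: "(\<lambda>v. trunc_deriv m k (x - v)) differentiable (at u within {a..b})"
    if "k < count_list ?xs x" for x k
  proof (cases "u \<noteq> x \<or> Suc k < m")
    case True
    then show ?thesis
      using DERIV_trunc_deriv_shift[OF True] differentiable_at_withinI real_differentiable_def by blast
  next
    case False
    with that cu have "u = a \<or> u = b" "k < m" "x = u" by auto
    then show ?thesis by (simp add: differentiable_trunc_deriv_endpoint)
  qed
  have "?f differentiable (at u within {a..b})"
    by (intro differentiable_mult differentiable_const differentiable_sum ballI finite_lessThan finite_set diff)
      auto
  moreover have "eventually (\<lambda>v. bspline m n t i v = ?f v) (nhds u)"
  proof -
    have "open (- (set ?xs - {u}))" by (intro open_Compl finite_imp_closed) simp
    then have "eventually (\<lambda>v. v \<in> - (set ?xs - {u})) (nhds u)"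
      by (rule eventually_nhds_in_open) simp
    then show ?thesis by eventually_elim (use eq in auto)
  qed
  ultimately show ?thesis
    using eq[of u] unfolding real_differentiable_def
    by (subst has_field_derivative_cong_eventually[of _ ?f])
      (auto simp: eventually_at_filter elim: eventually_mono)
next
  case False
  then have "bspline m n t i = (\<lambda>_. 0)" by (auto simp: bspline_def fun_eq_iff)
  then show ?thesis by simp
qed

text \<open>The B-spline agrees with a polynomial in \<open>u\<close> on the gap; its derivative
  brings a factor \<open>- m\<close> that cancels the \<open>m\<close> in the denominator. The point
  \<open>z\<close> will be the node to cancel.\<close>

lemma bspline_DERIV_on_gap:
  assumes "(bspline m n t i has_real_derivative D) (at u within {a..b})"
    and "a \<le> c" "c < d" "d \<le> b" "u \<in> {c..d}"
    and gap: "\<forall>x\<in>t ` {- int m..int n + int m}. x \<le> c \<or> d \<le> x"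
    and i: "- int m \<le> i" "i < int n"
  shows "bspline m n t i u + (z - u) / real m * D = (t (i + int m + 1) - t i) *
    (hermite_dd (nodes i) (gap_data d m u) - (z - u) * hermite_dd (nodes i) (gap_data d (m - 1) u))"
proof -
  let ?\<tau> = "t (i + int m + 1) - t i"
  have eq: "bspline m n t i v = ?\<tau> * hermite_dd (nodes i) (gap_data d m v)" if v: "v \<in> {c<..<d}" for v
  proof -
    have "hermite_dd (nodes i) (\<lambda>x k. (deriv ^^ k) (truncated_power m v) x) =
        hermite_dd (nodes i) (gap_data d m v)"
    proof (rule hermite_dd_cong)
      fix x k assume "x \<in> set (nodes i)"
      then have "x \<le> c \<or> d \<le> x" using gap set_nodes_subset[OF i] by blast
      \<comment> \<open>As \<open>v\<close> is not a node, the derivative formula holds for every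
        order \<open>k\<close>.\<close>
      with v show "(deriv ^^ k) (truncated_power m v) x = gap_data d m v x k"
        by (subst higher_deriv_truncated_power) (auto simp: trunc_deriv_def gap_data_def)
    qed
    then show ?thesis by (simp add: bspline_eq[OF i])
  qed
  have val: "bspline m n t i u = ?\<tau> * hermite_dd (nodes i) (gap_data d m u)"
    and D: "D = ?\<tau> * (- real m * hermite_dd (nodes i) (gap_data d (m - 1) u))"
    by (rule DERIV_within_eqI[OF assms(1) DERIV_cmult[OF DERIV_hermite_dd_gap_data[OF m]] assms(2-5)],
        erule eq)+
  show ?thesis unfolding val D using m by (simp add: field_simps)
qed

end

text \<open>Derivatives within an arbitrary subinterval cover the two-sided case and both one-sided
  ones. The first conjunct gives their existence, the second the relation whenever they
  exist.\<close>

theorem theorem3p3: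
  fixes m n :: nat and t :: "int \<Rightarrow> real" and i :: int and a b u :: real
  assumes "m \<ge> 1" and "n \<ge> 1"
    and "mono_on {- int m..int n + int m} t"
    and "t 0 < t (int n)"
    and "\<And>j. j \<in> {1..int n - 1} \<Longrightarrow> knot_multiplicity m n t (t j) \<le> m"
    and "i \<in> {- int m - 1..int n - 1}"
    and "t 0 \<le> a" and "a < b" and "b \<le> t (int n)"
    and "u \<in> {a..b}"
  shows "(knot_multiplicity m n t u < m \<or> u \<in> {a, b} \<and> knot_multiplicity m n t u \<le> m \<longrightarrow>
            bspline m n t i differentiable (at u within {a..b}) \<and>
            bspline m n t (i + 1) differentiable (at u within {a..b})) \<and>
         (\<forall>D\<^sub>0 D\<^sub>1.
            (bspline m n t i has_real_derivative D\<^sub>0) (at u within {a..b}) \<longrightarrow>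
            (bspline m n t (i + 1) has_real_derivative D\<^sub>1) (at u within {a..b}) \<longrightarrow>
            bspline m n t i u + (t i - u) / real m * D\<^sub>0 =
              (t (int m + i + 1) - t i) / (t (int m + i + 2) - t (i + 1)) *
              (bspline m n t (i + 1) u + (t (int m + i + 2) - u) / real m * D\<^sub>1))"
proof -
  interpret knots m n t by unfold_locales (use assms in auto)
  obtain c d where cd: "a \<le> c" "c < d" "d \<le> b" "u \<in> {c..d}"
    and gap: "\<forall>x\<in>t ` {- int m..int n + int m}. x \<le> c \<or> d \<le> x"
    using knot_gap[of "t ` {- int m..int n + int m}" a b u] assms(8,10) by auto
  have le: "t j \<le> t k" if "- int m \<le> j" "j \<le> k" "k \<le> int n + int m" for j k
    using mono that by (auto simp: mono_on_def)
  let ?H = "hermite_dd (middle_nodes i) (gap_data d (m - 1) u)"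
  \<comment> \<open>\<open>D\<close> is merely some derivative of the zero function, so
    \<open>D = 0\<close> is a uniqueness claim.\<close>
  have out: "bspline m n t j v = 0" "D = 0"
    if "\<not> (- int m \<le> j \<and> j < int n)"
      and D: "(bspline m n t j has_real_derivative D) (at u within {a..b})" for j v D
  proof -
    have 0: "bspline m n t j v = 0" for v using that(1) by (auto simp: bspline_def)
    show "bspline m n t j v = 0" by (rule 0)
    show "D = 0" by (rule DERIV_within_eqI(2)[OF D DERIV_const[of 0] cd]) (simp add: 0)
  qed
  have L: "bspline m n t i u + (t i - u) / real m * D = (t (int m + i + 1) - t i) * ?H"
    if D: "(bspline m n t i has_real_derivative D) (at u within {a..b})" "- int m \<le> i" for D
  proof -
    have "i < int n" using assms(6) by auto
    from bspline_DERIV_on_gap[OF D(1) cd gap D(2) this, of "t i"]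
    have "bspline m n t i u + (t i - u) / real m * D = (t (i + int m + 1) - t i) * ?H"
      by (simp only: nodes_eq_Cons hermite_dd_gap_data[OF m nodes_ne(2)])
    then show ?thesis by (simp only: add.commute[of i])
  qed
  \<comment> \<open>Mirror image of \<open>L\<close>: the last node is cancelled instead of the
    first, leaving the same \<open>?H\<close>.\<close>
  have R: "bspline m n t (i + 1) u + (t (int m + i + 2) - u) / real m * D =
      (t (int m + i + 2) - t (i + 1)) * ?H"
    if D: "(bspline m n t (i + 1) has_real_derivative D) (at u within {a..b})" "i + 1 < int n" for D
  proof -
    have "- int m \<le> i + 1" using assms(6) by auto
    from bspline_DERIV_on_gap[OF D(1) cd gap this D(2), of "t (int m + i + 2)"]
    have "bspline m n t (i + 1) u + (t (int m + i + 2) - u) / real m * D =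
        (t (i + 1 + int m + 1) - t (i + 1)) * ?H"
      by (simp only: nodes_eq_snoc hermite_dd_snoc hermite_dd_gap_data[OF m nodes_ne(2)])
    moreover have "i + 1 + int m + 1 = int m + i + 2" by simp
    ultimately show ?thesis by (simp only:)
  qed
  have "bspline m n t i u + (t i - u) / real m * D0 =
      (t (int m + i + 1) - t i) / (t (int m + i + 2) - t (i + 1)) *
      (bspline m n t (i + 1) u + (t (int m + i + 2) - u) / real m * D1)"
    if D0: "(bspline m n t i has_real_derivative D0) (at u within {a..b})"
      and D1: "(bspline m n t (i + 1) has_real_derivative D1) (at u within {a..b})" for D0 D1
  proof -
    consider "i = - int m - 1" | "i = int n - 1" | "- int m \<le> i" "i + 1 < int n"
      using assms(6) by fastforce
    then show ?thesis
    proof cases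
      \<comment> \<open>The right-hand bracket is 0, so the unspecified \<open>t i\<close> in the
        quotient is harmless.\<close>
      case 1
      have "?H = 0"
      proof (rule hermite_dd_gap_data_left)
        fix x assume "x \<in> set (middle_nodes i)"
        then have "x \<le> t 0" using 1 le by (auto simp: set_middle_nodes)
        then show "x < d" using assms(7) cd by linarith
      qed
      with R[OF D1] out[OF _ D0] 1 n show ?thesis by simp
    next
      \<comment> \<open>Now the B-spline on the right is zero with its derivative, whatever
        \<open>t (int m + i + 2)\<close> is.\<close>
      case 2
      have "?H = 0"
      proof (rule hermite_dd_gap_data_right)
        fix x assume "x \<in> set (middle_nodes i)"
        then have "t (int n) \<le> x" using 2 le by (auto simp: set_middle_nodes)
        then show "d \<le> x" using assms(9) cd by linarith
      qed (use m in \<open>simp add: length_middle_nodes\<close>)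
      with L[OF D0] out[OF _ D1] 2 n show ?thesis by simp
    next
      case 3
      \<comment> \<open>The denominator is nonzero, hence cancels.\<close>
      then have "t (i + 1) < t (int m + i + 2)"
        using knot_length_pos[of "i + 1"] by (simp add: algebra_simps)
      with L[OF D0] R[OF D1] 3 show ?thesis by simp
    qed
  qed
  then show ?thesis using differentiable_bspline by blast
qed

end
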